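(* Let $\mathcal{X}\subseteq\mathbb{R}^n$ be closed and convex, let $f:\mathcal{X}\to\mathbb{R}$ be a continuously differentiable convex function that is $L$-smooth with respect to a norm $\|\cdot\|$ and has a minimizer $\mathbf{x}_*\in\arg\min_{\mathbf{x}\in\mathcal{X}}f(\mathbf{x})$, and let $\mathbf{x}_0\in\mathcal{X}$ be an arbitrary initial point. Suppose the sequences $\mathbf{x}_k,\mathbf{y}_k,\mathbf{z}_k$ evolve according to the AGD+ algorithm (defined in the context) for some differentiable function $\psi:\mathcal{X}\to\mathbb{R}$ that is $\mu$-strongly convex with respect to $\|\cdot\|$ ($\mu>0$), with exact gradients (i.e. $\boldsymbol{\eta}_k=\mathbf{0}$ for all $k$), and with $\frac{a_k^2}{A_k}\le\frac{\mu}{L}$ for all $k\geq 1$. Then for all $k\ge 1$: $$f(\mathbf{y}_k)-f(\mathbf{x}_* )\le\frac{D_\psi(\mathbf{x}_*,\mathbf{x}_0)}{A_k}.$$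
   Context: $\|\cdot\|$ is an arbitrary fixed norm on $\mathbb{R}^n$, with dual norm $\|\cdot\|_*$. $f$ is $L$-smooth ($L>0$) on $\mathcal{X}$ if $f(\hat{\mathbf{x}})\le f(\mathbf{x})+\langle\nabla f(\mathbf{x}),\hat{\mathbf{x}}-\mathbf{x}\rangle+\frac{L}{2}\|\hat{\mathbf{x}}-\mathbf{x}\|^2$ for all $\mathbf{x},\hat{\mathbf{x}}\in\mathcal{X}$. $\psi$ is $\mu$-strongly convex on $\mathcal{X}$ if $\psi(\hat{\mathbf{x}})\ge \psi(\mathbf{x})+\langle\nabla \psi(\mathbf{x}),\hat{\mathbf{x}}-\mathbf{x}\rangle+\frac{\mu}{2}\|\hat{\mathbf{x}}-\mathbf{x}\|^2$ for all $\mathbf{x},\hat{\mathbf{x}}\in\mathcal{X}$. Bregman divergence: $D_\psi(\mathbf{x},\hat{\mathbf{x}})=\psi(\mathbf{x})-\psi(\hat{\mathbf{x}})-\langle\nabla\psi(\hat{\mathbf{x}}),\mathbf{x}-\hat{\mathbf{x}}\rangle$. Convex conjugate: $\psi^*(\mathbf{z})=\max_{\mathbf{x}\in\mathcal{X}}\{\langle\mathbf{z},\mathbf{x}\rangle-\psi(\mathbf{x})\}$, so that $\nabla\psi^*(\mathbf{z})=\arg\max_{\mathbf{x}\in\mathcal{X}}\{\langle\mathbf{z},\mathbf{x}\rangle-\psi(\mathbf{x})\}$. AGD+ algorithm: let $a_k>0$ ($k\ge1$), $A_k=\sum_{i=1}^k a_i$, $A_0=0$. A gradient oracle queried at $\mathbf{x}_k$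 returns $\widetilde{\nabla}f(\mathbf{x}_k)=\nabla f(\mathbf{x}_k)+\boldsymbol{\eta}_k$, where $\boldsymbol{\eta}_k$ is the additive error. Initialize $\mathbf{z}_0=\nabla\psi(\mathbf{x}_0)$, and set $\mathbf{x}_1=\mathbf{x}_0$, $\mathbf{z}_1=\mathbf{z}_0-a_1\widetilde{\nabla}f(\mathbf{x}_1)$, $\mathbf{y}_1=\nabla\psi^*(\mathbf{z}_1)$. For $k\ge2$: $$\mathbf{x}_k=\tfrac{A_{k-1}}{A_k}\mathbf{y}_{k-1}+\tfrac{a_k}{A_k}\nabla\psi^*(\mathbf{z}_{k-1}),\quad \mathbf{z}_k=\mathbf{z}_{k-1}-a_k\widetilde{\nabla}f(\mathbf{x}_k),\quad \mathbf{y}_k=\tfrac{A_{k-1}}{A_k}\mathbf{y}_{k-1}+\tfrac{a_k}{A_k}\nabla\psi^*(\mathbf{z}_k).$$ *)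

theory Defs
  imports "HOL-Analysis.Analysis"
begin

definition is_norm :: "(real ^ 'n \<Rightarrow> real) \<Rightarrow> bool" where
  "is_norm N \<longleftrightarrow>
     (\<forall>x. 0 \<le> N x) \<and> (\<forall>x. N x = 0 \<longleftrightarrow> x = 0) \<and>
     (\<forall>c x. N (c *\<^sub>R x) = \<bar>c\<bar> * N x) \<and> (\<forall>x y. N (x + y) \<le> N x + N y)"

text \<open>
  The set \<open>X\<close> may have boundary points or an empty interior, so gradients on \<open>X\<close> are
  taken within \<open>X\<close>. Then they need not be unique, and the gradient map \<open>g\<close> is passed
  around explicitly; only its inner products with differences of points of a convex \<open>X\<close>
  are determined by \<open>f\<close>. On an open \<open>X\<close> the condition is \<open>GDERIV f x :> g x\<close>.
\<close>

definition has_gradient_on ::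
    "(real ^ 'n \<Rightarrow> real) \<Rightarrow> (real ^ 'n \<Rightarrow> real ^ 'n) \<Rightarrow> (real ^ 'n) set \<Rightarrow> bool" where
  "has_gradient_on f g X \<longleftrightarrow>
     (\<forall>x\<in>X. (f has_derivative (\<lambda>h. h \<bullet> g x)) (at x within X))"

definition smooth_wrt ::
    "(real ^ 'n \<Rightarrow> real) \<Rightarrow> real \<Rightarrow> (real ^ 'n) set \<Rightarrow>
     (real ^ 'n \<Rightarrow> real) \<Rightarrow> (real ^ 'n \<Rightarrow> real ^ 'n) \<Rightarrow> bool" where
  "smooth_wrt N L X f gf \<longleftrightarrow>
     (\<forall>x\<in>X. \<forall>x'\<in>X. f x' \<le> f x + gf x \<bullet> (x' - x) + L / 2 * (N (x' - x))\<^sup>2)"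

definition strongly_convex_wrt ::
    "(real ^ 'n \<Rightarrow> real) \<Rightarrow> real \<Rightarrow> (real ^ 'n) set \<Rightarrow>
     (real ^ 'n \<Rightarrow> real) \<Rightarrow> (real ^ 'n \<Rightarrow> real ^ 'n) \<Rightarrow> bool" where
  "strongly_convex_wrt N \<mu> X \<psi> g\<psi> \<longleftrightarrow>
     (\<forall>x\<in>X. \<forall>x'\<in>X. \<psi> x' \<ge> \<psi> x + g\<psi> x \<bullet> (x' - x) + \<mu> / 2 * (N (x' - x))\<^sup>2)"

definition bregman ::
    "(real ^ 'n \<Rightarrow> real) \<Rightarrow> (real ^ 'n \<Rightarrow> real ^ 'n) \<Rightarrow> real ^ 'n \<Rightarrow> real ^ 'n \<Rightarrow> real" where
  "bregman \<psi> g\<psi> x x' = \<psi> x - \<psi> x' - g\<psi> x' \<bullet> (x - x')"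

text \<open>
  The supremum is attained whenever \<open>X\<close> is nonempty, closed and convex and \<open>\<psi>\<close> is
  differentiable and strongly convex on \<open>X\<close>, so it is then the maximum.
\<close>

definition conjugate :: "(real ^ 'n) set \<Rightarrow> (real ^ 'n \<Rightarrow> real) \<Rightarrow> real ^ 'n \<Rightarrow> real" where
  "conjugate X \<psi> z = (SUP x\<in>X. z \<bullet> x - \<psi> x)"

definition gradient :: "(real ^ 'n \<Rightarrow> real) \<Rightarrow> real ^ 'n \<Rightarrow> real ^ 'n" where
  "gradient h z = (THE D. GDERIV h z :> D)"

definition partial_sum :: "(nat \<Rightarrow> real) \<Rightarrow> nat \<Rightarrow> real" where
  "partial_sum a k = (\<Sum>i=1..k. a i)"

text \<open>
  \<open>\<eta> k\<close> is the additive error of the gradient oracle at \<open>x k\<close>. The values \<open>y 0\<close>,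
  \<open>a 0\<close> and \<open>\<eta> 0\<close> are not used by the algorithm and are left unconstrained.
\<close>

definition agd_plus ::
    "(real ^ 'n) set \<Rightarrow> (real ^ 'n \<Rightarrow> real ^ 'n) \<Rightarrow>
     (real ^ 'n \<Rightarrow> real) \<Rightarrow> (real ^ 'n \<Rightarrow> real ^ 'n) \<Rightarrow>
     (nat \<Rightarrow> real) \<Rightarrow> (nat \<Rightarrow> real ^ 'n) \<Rightarrow>
     (nat \<Rightarrow> real ^ 'n) \<Rightarrow> (nat \<Rightarrow> real ^ 'n) \<Rightarrow> (nat \<Rightarrow> real ^ 'n) \<Rightarrow> bool" where
  "agd_plus X gf \<psi> g\<psi> a \<eta> x y z \<longleftrightarrow>
     (let A = partial_sum a;
          grad_conj = gradient (conjugate X \<psi>);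
          oracle = (\<lambda>k. gf (x k) + \<eta> k)
      in z 0 = g\<psi> (x 0) \<and>
         x 1 = x 0 \<and>
         z 1 = z 0 - a 1 *\<^sub>R oracle 1 \<and>
         y 1 = grad_conj (z 1) \<and>
         (\<forall>k\<ge>2.
            x k = (A (k - 1) / A k) *\<^sub>R y (k - 1) + (a k / A k) *\<^sub>R grad_conj (z (k - 1)) \<and>
            z k = z (k - 1) - a k *\<^sub>R oracle k \<and>
            y k = (A (k - 1) / A k) *\<^sub>R y (k - 1) + (a k / A k) *\<^sub>R grad_conj (z k)))"

end

(* Estimate sequence. With v_k the maximizer defining the conjugate at z_k, the function
     S_k(u) = sum_{i<=k} a_i (f(x_i) + <gf(x_i), u - x_i>) + D_psi(u, x_0)
   differs from psi - <z_k, .> by a constant, so it is minimized over X at v_k and satisfies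
   S_k(u) >= S_k(v_k) + mu/2 N(u - v_k)^2. The invariant A_k f(y_k) <= S_k(v_k) is preserved
   because y_k - x_k = (a_k/A_k) (v_k - v_{k-1}): the smoothness error of A_k f(y_k) is
   L a_k^2/(2 A_k) N(v_k - v_{k-1})^2, which this growth term absorbs. By convexity of f,
   S_k(xstar) <= A_k f(xstar) + D_psi(xstar, x_0). *)
theory Submission
  imports Defs
begin

section \<open>Norms and gradients on convex sets\<close>

text \<open>\<open>N\<close> is convex, hence continuous in finite dimension, so it attains a
  positive minimum on the compact Euclidean unit sphere, and homogeneity extends the bound to all
  vectors. This lets strong convexity in \<open>N\<close> yield Euclidean estimates for compactness
  and differentiability.\<close>

lemma is_norm_ge_euclidean:
  fixes N :: "real ^ 'n \<Rightarrow> real"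
  assumes "is_norm N"
  obtains c where "c > 0" "\<And>v. c * norm v \<le> N v"
proof -
  have nonneg: "0 \<le> N v" and zero: "N v = 0 \<longleftrightarrow> v = 0"
    and scale: "N (r *\<^sub>R v) = \<bar>r\<bar> * N v" and tri: "N (v + w) \<le> N v + N w" for v w r
    using assms unfolding is_norm_def by blast+
  have "convex_on UNIV N"
  proof (rule convex_onI)
    fix t :: real and v w :: "real ^ 'n"
    assume "0 < t" "t < 1"
    then show "N ((1 - t) *\<^sub>R v + t *\<^sub>R w) \<le> (1 - t) * N v + t * N w"
      using tri[of "(1 - t) *\<^sub>R v" "t *\<^sub>R w"] by (simp add: scale)
  qed simp
  then have "continuous_on UNIV N"
    by (intro convex_on_continuous) auto
  then have "continuous_on (sphere 0 1) N"
    by (rule continuous_on_subset) simp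
  moreover have "axis undefined 1 \<in> sphere (0 :: real ^ 'n) 1"
    by simp
  ultimately obtain w where w: "w \<in> sphere 0 1" "\<And>u. u \<in> sphere 0 1 \<Longrightarrow> N w \<le> N u"
    using continuous_attains_inf[OF compact_sphere, of 0 1 N] by blast
  show ?thesis
  proof
    show "N w > 0"
      using w(1) nonneg[of w] zero[of w] by (auto simp: less_le)
    fix v :: "real ^ 'n"
    show "N w * norm v \<le> N v"
    proof (cases "v = 0")
      case False
      have "N w \<le> N ((1 / norm v) *\<^sub>R v)"
        using False by (intro w(2)) simp
      then show ?thesis
        using False by (simp add: scale field_simps)
    qed (simp add: nonneg)
  qed
qed

lemma has_gradient_on_continuous_on:
  "has_gradient_on f g X \<Longrightarrow> continuous_on X f"
  unfolding has_gradient_on_def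
  by (meson continuous_on_eq_continuous_within has_derivative_continuous)

text \<open>Along the segment from \<open>x\<close> to \<open>u\<close>, convexity bounds the
  difference quotients of \<open>f\<close> by \<open>f u - f x\<close>, and their one-sided limit is
  the slope \<open>(u - x) \<bullet> g x\<close>. The segment stays in \<open>X\<close>, so a
  derivative within \<open>X\<close> suffices even at boundary points.\<close>

lemma convex_on_has_gradient_on_above_tangent:
  assumes "convex_on X f" and "has_gradient_on f g X" and "x \<in> X" and "u \<in> X"
  shows "f x + g x \<bullet> (u - x) \<le> f u"
proof -
  let ?p = "\<lambda>t::real. x + t *\<^sub>R (u - x)"
  have p_eq: "?p t = (1 - t) *\<^sub>R x + t *\<^sub>R u" for t
    by (simp add: algebra_simps)
  have "convex X"
    using assms(1) by (rule convex_on_imp_convex)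
  then have sub: "?p ` {0..1} \<subseteq> X"
    using assms(3,4) unfolding p_eq convex_alt by auto
  have df: "(f has_derivative (\<lambda>h. h \<bullet> g x)) (at (?p 0) within ?p ` {0..1})"
    using assms(2,3) sub unfolding has_gradient_on_def by (auto intro: has_derivative_subset)
  have dp: "(?p has_derivative (\<lambda>t. t *\<^sub>R (u - x))) (at 0 within {0..1})"
    by (auto intro!: derivative_eq_intros)
  have "((\<lambda>t. f (?p t)) has_derivative (\<lambda>t. (t *\<^sub>R (u - x)) \<bullet> g x)) (at 0 within {0..1})"
    using has_derivative_in_compose[OF dp df] .
  then have "((\<lambda>t. f (?p t)) has_real_derivative (u - x) \<bullet> g x) (at 0 within {0..1})"
    unfolding has_field_derivative_def by (simp add: mult_commute_abs)
  then have lim: "((\<lambda>t. (f (?p t) - f x) / t) \<longlongrightarrow> (u - x) \<bullet> g x) (at 0 within {0..1})"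
    by (simp add: has_field_derivative_iff)
  have "eventually (\<lambda>t. (f (?p t) - f x) / t \<le> f u - f x) (at 0 within {0..1})"
    unfolding eventually_at_filter
  proof (intro always_eventually allI impI)
    fix t :: real
    assume t: "t \<noteq> 0" "t \<in> {0..1}"
    then have "f (?p t) \<le> (1 - t) * f x + t * f u"
      unfolding p_eq using assms(1,3,4) by (intro convex_onD) auto
    with t show "(f (?p t) - f x) / t \<le> f u - f x"
      by (simp add: field_simps)
  qed
  moreover have "at (0::real) within {0..1} \<noteq> bot"
    by (simp add: at_within_Icc_at_right)
  ultimately have "(u - x) \<bullet> g x \<le> f u - f x"
    using lim tendsto_upperbound by blast
  then show ?thesis
    by (simp add: inner_commute)
qed

lemma GDERIV_unique:
  assumes "GDERIV h z :> D" and "GDERIV h z :> E"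
  shows "D = E"
proof -
  have "(\<lambda>v. v \<bullet> D) = (\<lambda>v. v \<bullet> E)"
    using assms unfolding gderiv_def by (rule has_derivative_unique)
  then have "v \<bullet> D = v \<bullet> E" for v
    by (rule fun_cong)
  then show ?thesis
    using vector_eq_ldot[of D E] by blast
qed

lemma gradient_eqI: "GDERIV h z :> D \<Longrightarrow> gradient h z = D"
  unfolding gradient_def by (rule the_equality) (auto intro: GDERIV_unique)

lemma quadratic_error_imp_GDERIV:
  fixes h :: "'a::real_inner \<Rightarrow> real"
  assumes "\<And>w. \<bar>h w - h z - (w - z) \<bullet> D\<bar> \<le> C * (norm (w - z))\<^sup>2"
  shows "GDERIV h z :> D"
  unfolding gderiv_def has_derivative_at
proof (intro conjI)
  show "bounded_linear (\<lambda>v. v \<bullet> D)"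
    by (rule bounded_linear_inner_left)
  show "(\<lambda>v. norm (h (z + v) - h z - v \<bullet> D) / norm v) \<midarrow>0\<rightarrow> 0"
  proof (rule Lim_null_comparison)
    show "\<forall>\<^sub>F v in at 0. norm (norm (h (z + v) - h z - v \<bullet> D) / norm v) \<le> C * norm v"
    proof (intro always_eventually allI)
      fix v
      show "norm (norm (h (z + v) - h z - v \<bullet> D) / norm v) \<le> C * norm v"
        using assms[of "z + v"]
        by (cases "v = 0") (auto simp: divide_le_eq power2_eq_square mult.assoc)
    qed
    show "((\<lambda>v. C * norm v) \<longlongrightarrow> 0) (at 0)"
      by (auto intro!: tendsto_eq_intros)
  qed
qed

section \<open>The gradient of the conjugate of a strongly convex function\<close>

locale strongly_convex_on =
  fixes N :: "real ^ 'n \<Rightarrow> real" and X :: "(real ^ 'n) set"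
    and \<psi> :: "real ^ 'n \<Rightarrow> real" and g\<psi> :: "real ^ 'n \<Rightarrow> real ^ 'n" and \<mu> :: real
  assumes norm: "is_norm N"
    and closed: "closed X" and convex: "convex X" and nonempty: "X \<noteq> {}"
    and gradient: "has_gradient_on \<psi> g\<psi> X"
    and mu_pos: "\<mu> > 0" and strongly_convex: "strongly_convex_wrt N \<mu> X \<psi> g\<psi>"
begin

lemma N_scaleR: "N (c *\<^sub>R v) = \<bar>c\<bar> * N v"
  using norm unfolding is_norm_def by blast

lemma above_tangent:
  "x \<in> X \<Longrightarrow> u \<in> X \<Longrightarrow> \<psi> x + g\<psi> x \<bullet> (u - x) + \<mu> / 2 * (N (u - x))\<^sup>2 \<le> \<psi> u"
  using strongly_convex unfolding strongly_convex_wrt_def by blast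

text \<open>Apply the tangent inequality at the point dividing the chord to both endpoints, with
  weights \<open>1 - t\<close> and \<open>t\<close>. The gradient terms cancel, and the quadratic
  terms combine by \<open>(1 - t) * t\<^sup>2 + t * (1 - t)\<^sup>2 = t * (1 - t)\<close>.\<close>

lemma below_chord:
  assumes "v \<in> X" "u \<in> X" "0 \<le> t" "t \<le> 1"
  shows "\<psi> ((1 - t) *\<^sub>R v + t *\<^sub>R u) + \<mu> / 2 * t * (1 - t) * (N (u - v))\<^sup>2
    \<le> (1 - t) * \<psi> v + t * \<psi> u"
proof -
  define w where "w = (1 - t) *\<^sub>R v + t *\<^sub>R u"
  define i where "i = g\<psi> w \<bullet> (u - v)"
  have w: "w \<in> X"
    unfolding w_def using convex assms by (simp add: convex_alt)
  have vw: "v - w = (- t) *\<^sub>R (u - v)" and uw: "u - w = (1 - t) *\<^sub>R (u - v)"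
    unfolding w_def by (simp_all add: algebra_simps)
  have "\<psi> w - t * i + \<mu> / 2 * (t\<^sup>2 * (N (u - v))\<^sup>2) \<le> \<psi> v"
    using above_tangent[OF w assms(1)] unfolding vw N_scaleR i_def
    by (simp add: power_mult_distrib)
  moreover have "\<psi> w + (1 - t) * i + \<mu> / 2 * ((1 - t)\<^sup>2 * (N (u - v))\<^sup>2) \<le> \<psi> u"
    using above_tangent[OF w assms(2)] unfolding uw N_scaleR i_def
    by (simp add: power_mult_distrib)
  ultimately have "(1 - t) * (\<psi> w - t * i + \<mu> / 2 * (t\<^sup>2 * (N (u - v))\<^sup>2))
      + t * (\<psi> w + (1 - t) * i + \<mu> / 2 * ((1 - t)\<^sup>2 * (N (u - v))\<^sup>2))
    \<le> (1 - t) * \<psi> v + t * \<psi> u"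
    using assms(3,4) by (intro add_mono mult_left_mono) auto
  moreover have "(1 - t) * (\<psi> w - t * i + \<mu> / 2 * (t\<^sup>2 * (N (u - v))\<^sup>2))
      + t * (\<psi> w + (1 - t) * i + \<mu> / 2 * ((1 - t)\<^sup>2 * (N (u - v))\<^sup>2))
    = \<psi> w + \<mu> / 2 * t * (1 - t) * (N (u - v))\<^sup>2"
    by (simp add: field_simps power2_eq_square)
  ultimately show ?thesis
    unfolding w_def by simp
qed

definition maximizer :: "real ^ 'n \<Rightarrow> real ^ 'n \<Rightarrow> bool" where
  "maximizer z v \<longleftrightarrow> v \<in> X \<and> (\<forall>u\<in>X. z \<bullet> u - \<psi> u \<le> z \<bullet> v - \<psi> v)"

text \<open>Comparing \<open>v\<close> with points of the segment towards \<open>u\<close> and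
  letting them tend to \<open>v\<close> recovers the full constant \<open>\<mu> / 2\<close>, without
  stating a first-order optimality condition.\<close>

lemma maximizer_growth:
  assumes "maximizer z v" and "u \<in> X"
  shows "z \<bullet> u - \<psi> u + \<mu> / 2 * (N (u - v))\<^sup>2 \<le> z \<bullet> v - \<psi> v"
proof -
  let ?q = "\<mu> / 2 * (N (u - v))\<^sup>2"
  have v: "v \<in> X" "\<And>u. u \<in> X \<Longrightarrow> z \<bullet> u - \<psi> u \<le> z \<bullet> v - \<psi> v"
    using assms(1) unfolding maximizer_def by auto
  have "(1 - t) * ?q \<le> z \<bullet> v - \<psi> v - (z \<bullet> u - \<psi> u)" if t: "0 < t" "t < 1" for t
  proof -
    have "(1 - t) *\<^sub>R v + t *\<^sub>R u \<in> X"
      using convex v(1) assms(2) t by (simp add: convex_alt)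
    \<comment> \<open>Both the objective gap and the curvature term carry a factor \<open>t\<close>,
      which is then divided out.\<close>
    from v(2)[OF this] below_chord[OF v(1) assms(2), of t] t
    have "t * ((1 - t) * ?q) \<le> t * (z \<bullet> v - \<psi> v - (z \<bullet> u - \<psi> u))"
      by (simp add: inner_add_right algebra_simps)
    then show ?thesis
      using t by simp
  qed
  then have "\<forall>\<^sub>F t in at_right (0::real). (1 - t) * ?q \<le> z \<bullet> v - \<psi> v - (z \<bullet> u - \<psi> u)"
    unfolding eventually_at_right_field by (intro exI[of _ 1]) auto
  moreover have "((\<lambda>t. (1 - t) * ?q) \<longlongrightarrow> (1 - 0) * ?q) (at_right (0::real))"
    by (intro tendsto_intros)
  ultimately have "(1 - 0) * ?q \<le> z \<bullet> v - \<psi> v - (z \<bullet> u - \<psi> u)"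
    using tendsto_upperbound trivial_limit_at_right_real by blast
  then show ?thesis
    by simp
qed

text \<open>Strong convexity makes the objective coercive: a superlevel set through a point of
  \<open>X\<close> is closed and bounded, so the continuous objective attains its maximum
  there.\<close>

lemma maximizer_exists: "\<exists>v. maximizer z v"
proof -
  obtain x where x: "x \<in> X"
    using nonempty by blast
  obtain c where c: "c > 0" "\<And>v. c * norm v \<le> N v"
    using is_norm_ge_euclidean[OF norm] by blast
  \<comment> \<open>Since \<open>c * norm v \<le> N v\<close>, \<open>m\<close> can replace
    \<open>\<mu> / 2\<close> once \<open>N\<close> is replaced by the Euclidean norm.\<close>
  define m where "m = \<mu> / 2 * c\<^sup>2"
  have "m > 0"
    unfolding m_def using mu_pos c(1) by simp
  define K where "K = {u \<in> X. z \<bullet> x - \<psi> x \<le> z \<bullet> u - \<psi> u}"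
  have cont: "continuous_on X (\<lambda>u. z \<bullet> u - \<psi> u)"
    by (intro continuous_intros has_gradient_on_continuous_on[OF gradient])
  \<comment> \<open>On \<open>K\<close> the quadratic growth of \<open>\<psi>\<close> away from
    \<open>x\<close> is dominated by a linear term, which bounds the distance to
    \<open>x\<close>.\<close>
  have "norm (u - x) \<le> norm (z - g\<psi> x) / m" if "u \<in> K" for u
  proof (cases "u = x")
    case True
    then show ?thesis using \<open>m > 0\<close> by simp
  next
    case False
    have "m * (norm (u - x))\<^sup>2 \<le> \<mu> / 2 * (N (u - x))\<^sup>2"
      using power_mono[OF c(2)[of "u - x"], of 2] c(1) mu_pos
      unfolding m_def by (simp add: power_mult_distrib)
    also have "\<dots> \<le> (z - g\<psi> x) \<bullet> (u - x)"
      using above_tangent[OF x, of u] that unfolding K_def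
      by (simp add: inner_diff_left inner_diff_right)
    also have "\<dots> \<le> norm (z - g\<psi> x) * norm (u - x)"
      by (rule norm_cauchy_schwarz)
    finally have "m * norm (u - x) \<le> norm (z - g\<psi> x)"
      using False by (simp add: power2_eq_square mult.assoc[symmetric])
    then show ?thesis
      using \<open>m > 0\<close> by (simp add: field_simps)
  qed
  then have "bounded K"
    unfolding bounded_def by (metis dist_commute dist_norm)
  moreover have "closed K"
    unfolding K_def using continuous_closed_preimage[OF cont closed, of "{z \<bullet> x - \<psi> x..}"]
    by (simp add: vimage_def Int_def)
  ultimately have "compact K"
    by (simp add: compact_eq_bounded_closed)
  moreover have "K \<noteq> {}"
    unfolding K_def using x by blast
  moreover have "continuous_on K (\<lambda>u. z \<bullet> u - \<psi> u)"
    using cont by (rule continuous_on_subset) (auto simp: K_def)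
  ultimately obtain v where v: "v \<in> K" "\<And>u. u \<in> K \<Longrightarrow> z \<bullet> u - \<psi> u \<le> z \<bullet> v - \<psi> v"
    using continuous_attains_sup[of K "\<lambda>u. z \<bullet> u - \<psi> u"] by blast
  \<comment> \<open>Outside \<open>K\<close> the objective is below its value at \<open>x\<close>,
    hence below its value at \<open>v\<close>.\<close>
  have "z \<bullet> u - \<psi> u \<le> z \<bullet> v - \<psi> v" if "u \<in> X" for u
    using v that unfolding K_def by (cases "u \<in> K") (auto simp: K_def)
  with v(1) show ?thesis
    unfolding maximizer_def K_def by blast
qed

lemma conjugate_eq: "maximizer z v \<Longrightarrow> conjugate X \<psi> z = z \<bullet> v - \<psi> v"
  unfolding conjugate_def maximizer_def by (intro cSup_eq_maximum) auto

text \<open>The remainder of the conjugate at \<open>z\<close> is nonnegative because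
  \<open>v\<close> competes in the maximum at \<open>w\<close>. It is at most quadratic because
  moving from \<open>v\<close> to the maximizer \<open>v'\<close> at \<open>w\<close> costs the
  growth term, while the gain is linear in \<open>v' - v\<close>.\<close>

lemma GDERIV_conjugate:
  assumes "maximizer z v"
  shows "GDERIV (conjugate X \<psi>) z :> v"
proof -
  obtain c where c: "c > 0" "\<And>v. c * norm v \<le> N v"
    using is_norm_ge_euclidean[OF norm] by blast
  define m where "m = \<mu> / 2 * c\<^sup>2"
  have m: "m > 0"
    unfolding m_def using mu_pos c(1) by simp
  have "\<bar>conjugate X \<psi> w - conjugate X \<psi> z - (w - z) \<bullet> v\<bar> \<le> 1 / (4 * m) * (norm (w - z))\<^sup>2" for w
  proof -
    obtain v' where v': "maximizer w v'"
      using maximizer_exists by blast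
    let ?d = "conjugate X \<psi> w - conjugate X \<psi> z - (w - z) \<bullet> v"
    have "w \<bullet> v - \<psi> v \<le> w \<bullet> v' - \<psi> v'"
      using v' assms unfolding maximizer_def by blast
    then have "0 \<le> ?d"
      using conjugate_eq[OF assms] conjugate_eq[OF v'] by (simp add: inner_diff_left)
    have "m * (norm (v' - v))\<^sup>2 \<le> \<mu> / 2 * (N (v' - v))\<^sup>2"
      using power_mono[OF c(2)[of "v' - v"], of 2] c(1) mu_pos
      unfolding m_def by (simp add: power_mult_distrib)
    moreover have "z \<bullet> v' - \<psi> v' + \<mu> / 2 * (N (v' - v))\<^sup>2 \<le> z \<bullet> v - \<psi> v"
      using maximizer_growth[OF assms] v' unfolding maximizer_def by blast
    ultimately have "?d \<le> (w - z) \<bullet> (v' - v) - m * (norm (v' - v))\<^sup>2"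
      using conjugate_eq[OF assms] conjugate_eq[OF v']
      by (simp add: inner_diff_left inner_diff_right)
    also have "\<dots> \<le> norm (w - z) * norm (v' - v) - m * (norm (v' - v))\<^sup>2"
      by (simp add: norm_cauchy_schwarz)
    \<comment> \<open>Completing the square: \<open>b * s - m * s\<^sup>2\<close> is at most
      \<open>b\<^sup>2 / (4 * m)\<close>.\<close>
    also have "\<dots> \<le> 1 / (4 * m) * (norm (w - z))\<^sup>2"
      using zero_le_power2[of "norm (w - z) - 2 * m * norm (v' - v)"] m
      by (simp add: field_simps power2_eq_square)
    finally show ?thesis
      using \<open>0 \<le> ?d\<close> by simp
  qed
  then show ?thesis
    by (rule quadratic_error_imp_GDERIV)
qed

lemma gradient_conjugate_eq: "maximizer z v \<Longrightarrow> Defs.gradient (conjugate X \<psi>) z = v"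
  by (intro gradient_eqI GDERIV_conjugate)

lemma maximizer_gradient_conjugate: "maximizer z (Defs.gradient (conjugate X \<psi>) z)"
  using maximizer_exists gradient_conjugate_eq by metis

text \<open>The tangent inequality without its quadratic term, rearranged. It shows that the initial
  dual point \<open>g\<psi> (x 0)\<close> is mapped back to \<open>x 0\<close>.\<close>

lemma maximizer_gradient: "x \<in> X \<Longrightarrow> maximizer (g\<psi> x) x"
  unfolding maximizer_def
proof (intro conjI ballI)
  fix u
  assume "x \<in> X" "u \<in> X"
  moreover have "0 \<le> \<mu> / 2 * (N (u - x))\<^sup>2"
    using mu_pos by simp
  ultimately show "g\<psi> x \<bullet> u - \<psi> u \<le> g\<psi> x \<bullet> x - \<psi> x"
    using above_tangent[of x u] by (simp add: inner_diff_right)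
qed

end

section \<open>The estimate sequence\<close>

definition estimate ::
    "(real ^ 'n \<Rightarrow> real) \<Rightarrow> (real ^ 'n \<Rightarrow> real ^ 'n) \<Rightarrow>
     (real ^ 'n \<Rightarrow> real) \<Rightarrow> (real ^ 'n \<Rightarrow> real ^ 'n) \<Rightarrow>
     (nat \<Rightarrow> real) \<Rightarrow> (nat \<Rightarrow> real ^ 'n) \<Rightarrow> nat \<Rightarrow> real ^ 'n \<Rightarrow> real" where
  "estimate f gf \<psi> g\<psi> a x k u =
     (\<Sum>i=1..k. a i * (f (x i) + gf (x i) \<bullet> (u - x i))) + bregman \<psi> g\<psi> u (x 0)"

text \<open>The slopes accumulated by the linear models, together with the slope from the Bregman
  term, add up to \<open>- z k\<close>. Taking differences removes the additive constant, so growth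
  of the conjugate objective transfers to the estimate.\<close>

lemma estimate_diff:
  assumes "z 0 = g\<psi> (x 0)" and "\<And>k. z (Suc k) = z k - a (Suc k) *\<^sub>R gf (x (Suc k))"
  shows "estimate f gf \<psi> g\<psi> a x k u - estimate f gf \<psi> g\<psi> a x k v
    = (z k \<bullet> v - \<psi> v) - (z k \<bullet> u - \<psi> u)"
proof (induction k)
  case 0
  show ?case
    by (simp add: estimate_def bregman_def assms(1) inner_diff_right)
next
  case (Suc k)
  then show ?case
    by (simp add: estimate_def assms(2) inner_diff_right inner_diff_left algebra_simps)
qed

theorem theorem3p4:
  fixes N :: "real ^ 'n \<Rightarrow> real"
    and X :: "(real ^ 'n) set"
    and f \<psi> :: "real ^ 'n \<Rightarrow> real"
    and gf g\<psi> :: "real ^ 'n \<Rightarrow> real ^ 'n"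
    and L \<mu> :: real
    and xstar :: "real ^ 'n"
    and a :: "nat \<Rightarrow> real"
    and \<eta> x y z :: "nat \<Rightarrow> real ^ 'n"
  assumes "is_norm N"
    and "closed X" and "convex X"
    and "has_gradient_on f gf X" and "continuous_on X gf"
    and "convex_on X f"
    and "L > 0" and "smooth_wrt N L X f gf"
    and "is_arg_min f (\<lambda>v. v \<in> X) xstar"
    and "x 0 \<in> X"
    and "has_gradient_on \<psi> g\<psi> X"
    and "\<mu> > 0" and "strongly_convex_wrt N \<mu> X \<psi> g\<psi>"
    and "\<forall>k\<ge>1. a k > 0"
    and "agd_plus X gf \<psi> g\<psi> a \<eta> x y z"
    and "\<forall>k\<ge>1. \<eta> k = 0"
    and "\<forall>k\<ge>1. (a k)\<^sup>2 / partial_sum a k \<le> \<mu> / L"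
  shows "\<forall>k\<ge>1. f (y k) - f xstar \<le> bregman \<psi> g\<psi> xstar (x 0) / partial_sum a k"
proof -
  interpret strongly_convex_on N X \<psi> g\<psi> \<mu>
    using assms(1-3,10-13) by unfold_locales auto
  define A where "A = partial_sum a"
  define v where "v k = Defs.gradient (conjugate X \<psi>) (z k)" for k
  \<comment> \<open>Replacing the irrelevant \<open>y 0\<close> by \<open>x 0\<close> makes the first step an instance of the general one.\<close>
  define w where "w = y(0 := x 0)"
  define S where "S = estimate f gf \<psi> g\<psi> a x"
  have A0: "A 0 = 0" and A_Suc: "A (Suc k) = A k + a (Suc k)" for k
    by (simp_all add: A_def partial_sum_def)
  have a_pos: "a (Suc k) > 0" for k
    using assms(14) by simp
  have A_nonneg: "A k \<ge> 0" for k
    by (induction k) (use a_pos in \<open>auto simp: A0 A_Suc intro: add_nonneg_nonneg less_imp_le\<close>)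
  have A_pos: "A (Suc k) > 0" for k
    using A_nonneg[of k] a_pos[of k] by (simp add: A_Suc)
  note alg = assms(15)[unfolded agd_plus_def Let_def, folded A_def]
  have z0: "z 0 = g\<psi> (x 0)"
    using alg by blast
  have z_Suc: "z (Suc k) = z k - a (Suc k) *\<^sub>R gf (x (Suc k))" for k
    using alg assms(16) by (cases k) (auto simp: numeral_2_eq_2)
  have v_max: "maximizer (z k) (v k)" for k
    unfolding v_def by (rule maximizer_gradient_conjugate)
  then have v_in: "v k \<in> X" for k
    unfolding maximizer_def by blast
  have v0: "v 0 = x 0"
    unfolding v_def z0 using assms(10) by (intro gradient_conjugate_eq maximizer_gradient)
  \<comment> \<open>For \<open>k = 0\<close> the weights are 0 and 1 because \<open>A 0 = 0\<close>,
    and the identity reduces to \<open>x 1 = v 0 = x 0\<close>.\<close>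
  have x_Suc: "x (Suc k) = (A k / A (Suc k)) *\<^sub>R w k + (a (Suc k) / A (Suc k)) *\<^sub>R v k" for k
  proof (cases k)
    case 0
    with alg a_pos[of 0] show ?thesis
      by (simp add: A0 A_Suc v0)
  next
    case (Suc j)
    with alg show ?thesis
      by (auto simp: w_def v_def numeral_2_eq_2)
  qed
  have w_Suc: "w (Suc k) = (A k / A (Suc k)) *\<^sub>R w k + (a (Suc k) / A (Suc k)) *\<^sub>R v (Suc k)" for k
  proof (cases k)
    case 0
    with alg a_pos[of 0] show ?thesis
      by (simp add: A0 A_Suc w_def v_def)
  next
    case (Suc j)
    with alg show ?thesis
      by (auto simp: w_def v_def numeral_2_eq_2)
  qed
  have mix: "(A k / A (Suc k)) *\<^sub>R p + (a (Suc k) / A (Suc k)) *\<^sub>R q \<in> X"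
    if "p \<in> X" "q \<in> X" for k p q
    using A_pos[of k] A_nonneg[of k] a_pos[of k]
    by (intro convexD[OF convex that]) (auto simp: A_Suc add_divide_distrib[symmetric])
  have w_in: "w k \<in> X" for k
  proof (induction k)
    case 0
    show ?case
      using assms(10) by (simp add: w_def)
  qed (unfold w_Suc, intro mix v_in)
  have x_in: "x (Suc k) \<in> X" for k
    unfolding x_Suc by (intro mix v_in w_in)
  note tangent = convex_on_has_gradient_on_above_tangent[OF assms(6,4)]
  have S_growth: "S k (v k) + \<mu> / 2 * (N (u - v k))\<^sup>2 \<le> S k u" if "u \<in> X" for k u
    using maximizer_growth[OF v_max that, of k]
      estimate_diff[of z g\<psi> x a gf, OF z0 z_Suc, of f \<psi> k u "v k"]
    unfolding S_def by simp
  have S_Suc: "S (Suc k) u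
    = S k u + a (Suc k) * (f (x (Suc k)) + gf (x (Suc k)) \<bullet> (u - x (Suc k)))" for k u
    by (simp add: S_def estimate_def)
  have invariant: "A k * f (w k) \<le> S k (v k)" for k
  proof (induction k)
    case 0
    \<comment> \<open>Both sides vanish: \<open>A 0 = 0\<close>, and the Bregman divergence is taken
      from \<open>x 0\<close> to itself.\<close>
    show ?case
      by (simp add: A0 S_def estimate_def bregman_def v0)
  next
    case (Suc k)
    let ?x = "x (Suc k)" and ?a = "a (Suc k)" and ?A = "A (Suc k)"
    let ?g = "gf ?x" and ?n = "N (v (Suc k) - v k)"
    have wx: "w (Suc k) - ?x = (?a / ?A) *\<^sub>R (v (Suc k) - v k)"
      unfolding w_Suc x_Suc by (simp add: algebra_simps)
    have Aw: "?A *\<^sub>R w (Suc k) = A k *\<^sub>R w k + ?a *\<^sub>R v (Suc k)"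
      unfolding w_Suc using A_pos[of k] by (simp add: scaleR_add_right)
    have "?a\<^sup>2 / ?A * L \<le> \<mu>"
      using assms(7) assms(17)[rule_format, of "Suc k"] by (simp add: A_def pos_le_divide_eq)
    then have "?a\<^sup>2 / ?A * L * (?n\<^sup>2 / 2) \<le> \<mu> * (?n\<^sup>2 / 2)"
      by (rule mult_right_mono) simp
    moreover have "?A * (L / 2 * (?a / ?A * ?n)\<^sup>2) = ?a\<^sup>2 / ?A * L * (?n\<^sup>2 / 2)"
      using A_pos[of k] by (simp add: field_simps power2_eq_square)
    ultimately have absorb: "?A * (L / 2 * (?a / ?A * ?n)\<^sup>2) \<le> \<mu> / 2 * ?n\<^sup>2"
      by simp
    have "f (w (Suc k)) \<le> f ?x + ?g \<bullet> (w (Suc k) - ?x) + L / 2 * (N (w (Suc k) - ?x))\<^sup>2"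
      using assms(8) x_in w_in unfolding smooth_wrt_def by blast
    moreover have "N (w (Suc k) - ?x) = ?a / ?A * ?n"
      unfolding wx N_scaleR using A_pos[of k] a_pos[of k] by simp
    ultimately have "?A * f (w (Suc k))
      \<le> ?A * (f ?x + ?g \<bullet> (w (Suc k) - ?x) + L / 2 * (?a / ?A * ?n)\<^sup>2)"
      using A_pos[of k] by simp
    also have "\<dots> = ?A * f ?x + ?g \<bullet> (?A *\<^sub>R w (Suc k) - ?A *\<^sub>R ?x)
        + ?A * (L / 2 * (?a / ?A * ?n)\<^sup>2)"
      by (simp add: algebra_simps inner_diff_right)
    also have "\<dots> \<le> ?A * f ?x + ?g \<bullet> (?A *\<^sub>R w (Suc k) - ?A *\<^sub>R ?x) + \<mu> / 2 * ?n\<^sup>2"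
      using absorb by simp
    \<comment> \<open>Splitting \<open>?A\<close> as \<open>A k + ?a\<close> and using the mixture
      \<open>Aw\<close> separates the tangent at \<open>?x\<close> into its values at
      \<open>w k\<close> and at \<open>v (Suc k)\<close>.\<close>
    also have "\<dots> = A k * (f ?x + ?g \<bullet> (w k - ?x)) + \<mu> / 2 * ?n\<^sup>2
        + ?a * (f ?x + ?g \<bullet> (v (Suc k) - ?x))"
      unfolding Aw by (simp add: A_Suc algebra_simps inner_diff_right inner_add_right)
    also have "\<dots> \<le> A k * f (w k) + \<mu> / 2 * ?n\<^sup>2 + ?a * (f ?x + ?g \<bullet> (v (Suc k) - ?x))"
      using mult_left_mono[OF tangent[OF x_in w_in, of k k] A_nonneg[of k]] by simp
    \<comment> \<open>The induction hypothesis and the growth of \<open>S k\<close> away from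
      \<open>v k\<close>, taken at \<open>v (Suc k)\<close>, absorb the first two terms; the third
      is the new summand of \<open>S (Suc k)\<close>.\<close>
    also have "\<dots> \<le> S (Suc k) (v (Suc k))"
      unfolding S_Suc using Suc.IH S_growth[OF v_in, of k "Suc k"] by simp
    finally show ?case .
  qed
  have xstar: "xstar \<in> X"
    using assms(9) unfolding is_arg_min_def by blast
  \<comment> \<open>Each linear model lies below \<open>f\<close> at \<open>xstar\<close>, and the
    weights sum to \<open>A k\<close>.\<close>
  have S_upper: "S k xstar \<le> A k * f xstar + bregman \<psi> g\<psi> xstar (x 0)" for k
  proof (induction k)
    case (Suc k)
    with mult_left_mono[OF tangent[OF x_in xstar, of k] less_imp_le[OF a_pos[of k]]] show ?case
      by (simp add: S_Suc A_Suc algebra_simps)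
  qed (simp add: A0 S_def estimate_def)
  show ?thesis
  proof (intro allI impI)
    fix k :: nat
    assume "k \<ge> 1"
    then have "w k = y k" and pos: "A k > 0"
      using A_pos[of "k - 1"] by (auto simp: w_def)
    \<comment> \<open>At the end only minimality of \<open>v k\<close> matters, so the growth term
      at \<open>xstar\<close> is discarded.\<close>
    have "0 \<le> \<mu> / 2 * (N (xstar - v k))\<^sup>2"
      using mu_pos by simp
    with invariant[of k] S_growth[OF xstar, of k] S_upper[of k]
    have "A k * f (y k) \<le> A k * f xstar + bregman \<psi> g\<psi> xstar (x 0)"
      unfolding \<open>w k = y k\<close> by linarith
    with pos show "f (y k) - f xstar \<le> bregman \<psi> g\<psi> xstar (x 0) / partial_sum a k"
      unfolding A_def by (simp add: field_simps)
  qed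
qed

end
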